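(* Let $(X,\mathcal{T}_1,\mathcal{T}_2,E)$ be a bi-soft topological space over $X$. Then the following are equivalent: (1) $(X,\mathcal{T}_1,\mathcal{T}_2,E)$ is a pair-wise soft Hausdorff (pair-wise soft $T_2$) space over $X$. (2) For every $x\in X$ and every point $y\in X$ distinct from $x$, there is a soft set $(F,E)\in\mathcal{T}_1$ such that $x\in(F,E)$ and $y\in \widetilde{X}-\overline{(F,E)}^{\mathcal{T}_2}$.
   Context: $X$ is a set (initial universe) and $E$ is a non-empty set of parameters. A soft set $(F,E)$ over $X$ is a map $F:E\to\mathcal{P}(X)$, where $\mathcal{P}(X)$ is the power set of $X$. Unions, intersections, differences, complements of soft sets are taken parameterwise, e.g. $((F,E)-(G,E))(e)=F(e)-G(e)$ and $(F,E)^c(e)=X-F(e)$ for all $e\in E$. $\Phi$ denotes the soft set with value $\emptyset$ at every $e\in E$ and $\widetilde{X}$ the soft set with value $X$ at every $e\in E$. $(F,E)$ is a soft subset of $(G,E)$ if $F(e)\subseteq G(e)$ for all $e\in E$. For $x\in X$, $x\in(F,E)$ means $x\in F(e)$ for all $e\in E$ (so $x\notin(F,E)$ means $x\notin F(e)$ for some $e\in E$). A soft topology on $X$ is a collection $\mathcal{T}$ of soft sets over $X$ (with parameter set $E$) containing $\Phi$ and $\widetilde{X}$ and closed under arbitrary unions and under intersections of two members. Its members are called soft open; a soft set is soft closed if its complement is soft open. A bi-soft topological space $(X,\mathcal{T}_1,\mathcal{T}_2,E)$ consists of two soft topologies $\mathcal{T}_1,\mathcal{T}_2$ on $X$ with the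 same parameter set $E$. The soft closure $\overline{(F,E)}^{\mathcal{T}}$ of $(F,E)$ with respect to $\mathcal{T}$ is the intersection of all soft sets that are soft closed in $(X,\mathcal{T},E)$ and contain $(F,E)$ as a soft subset. $(X,\mathcal{T}_1,\mathcal{T}_2,E)$ is pair-wise soft $T_2$ (pair-wise soft Hausdorff) if for all $x,y\in X$ with $x\ne y$ there are $(F,E)\in\mathcal{T}_1$ and $(G,E)\in\mathcal{T}_2$ with $x\in(F,E)$, $y\in(G,E)$ and $(F,E)\cap(G,E)=\Phi$. *)

theory Defs
  imports Main "HOL-Library.FuncSet"
begin

text \<open>
  The universe \<open>X\<close> and the parameter set \<open>E\<close> are carrier sets. A soft set over \<open>X\<close> is an
  extensional function from \<open>E\<close> to the power set of \<open>X\<close>, so that HOL equality of soft sets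
  is equality at every parameter of \<open>E\<close>.
\<close>

definition soft_sets :: "'a set \<Rightarrow> 'e set \<Rightarrow> ('e \<Rightarrow> 'a set) set" where
  "soft_sets X E = (E \<rightarrow>\<^sub>E Pow X)"

definition soft_empty :: "'e set \<Rightarrow> 'e \<Rightarrow> 'a set" where
  "soft_empty E = (\<lambda>e\<in>E. {})"

definition soft_univ :: "'a set \<Rightarrow> 'e set \<Rightarrow> 'e \<Rightarrow> 'a set" where
  "soft_univ X E = (\<lambda>e\<in>E. X)"

definition soft_subset :: "'e set \<Rightarrow> ('e \<Rightarrow> 'a set) \<Rightarrow> ('e \<Rightarrow> 'a set) \<Rightarrow> bool" where
  "soft_subset E F G \<longleftrightarrow> (\<forall>e\<in>E. F e \<subseteq> G e)"

definition soft_mem :: "'e set \<Rightarrow> 'a \<Rightarrow> ('e \<Rightarrow> 'a set) \<Rightarrow> bool" where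
  "soft_mem E x F \<longleftrightarrow> (\<forall>e\<in>E. x \<in> F e)"

definition soft_inter :: "'e set \<Rightarrow> ('e \<Rightarrow> 'a set) \<Rightarrow> ('e \<Rightarrow> 'a set) \<Rightarrow> 'e \<Rightarrow> 'a set" where
  "soft_inter E F G = (\<lambda>e\<in>E. F e \<inter> G e)"

definition soft_diff :: "'e set \<Rightarrow> ('e \<Rightarrow> 'a set) \<Rightarrow> ('e \<Rightarrow> 'a set) \<Rightarrow> 'e \<Rightarrow> 'a set" where
  "soft_diff E F G = (\<lambda>e\<in>E. F e - G e)"

definition soft_compl :: "'a set \<Rightarrow> 'e set \<Rightarrow> ('e \<Rightarrow> 'a set) \<Rightarrow> 'e \<Rightarrow> 'a set" where
  "soft_compl X E F = (\<lambda>e\<in>E. X - F e)"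

definition soft_Union :: "'e set \<Rightarrow> ('e \<Rightarrow> 'a set) set \<Rightarrow> 'e \<Rightarrow> 'a set" where
  "soft_Union E \<F> = (\<lambda>e\<in>E. \<Union>F\<in>\<F>. F e)"

text \<open>
  The value at the empty family is irrelevant below: closures only use this for families
  containing \<^term>\<open>soft_univ X E\<close>.
\<close>

definition soft_Inter :: "'e set \<Rightarrow> ('e \<Rightarrow> 'a set) set \<Rightarrow> 'e \<Rightarrow> 'a set" where
  "soft_Inter E \<F> = (\<lambda>e\<in>E. \<Inter>F\<in>\<F>. F e)"

definition soft_topology :: "'a set \<Rightarrow> 'e set \<Rightarrow> ('e \<Rightarrow> 'a set) set \<Rightarrow> bool" where
  "soft_topology X E \<T> \<longleftrightarrow>
     \<T> \<subseteq> soft_sets X E \<and>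
     soft_empty E \<in> \<T> \<and>
     soft_univ X E \<in> \<T> \<and>
     (\<forall>\<F>. \<F> \<subseteq> \<T> \<longrightarrow> soft_Union E \<F> \<in> \<T>) \<and>
     (\<forall>F\<in>\<T>. \<forall>G\<in>\<T>. soft_inter E F G \<in> \<T>)"

definition soft_closed :: "'a set \<Rightarrow> 'e set \<Rightarrow> ('e \<Rightarrow> 'a set) set \<Rightarrow> ('e \<Rightarrow> 'a set) \<Rightarrow> bool" where
  "soft_closed X E \<T> F \<longleftrightarrow> F \<in> soft_sets X E \<and> soft_compl X E F \<in> \<T>"

definition soft_closure ::
  "'a set \<Rightarrow> 'e set \<Rightarrow> ('e \<Rightarrow> 'a set) set \<Rightarrow> ('e \<Rightarrow> 'a set) \<Rightarrow> 'e \<Rightarrow> 'a set" where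
  "soft_closure X E \<T> F = soft_Inter E {H. soft_closed X E \<T> H \<and> soft_subset E F H}"

definition bi_soft_topological_space ::
  "'a set \<Rightarrow> ('e \<Rightarrow> 'a set) set \<Rightarrow> ('e \<Rightarrow> 'a set) set \<Rightarrow> 'e set \<Rightarrow> bool" where
  "bi_soft_topological_space X \<T>1 \<T>2 E \<longleftrightarrow>
     E \<noteq> {} \<and> soft_topology X E \<T>1 \<and> soft_topology X E \<T>2"

definition pairwise_soft_Hausdorff ::
  "'a set \<Rightarrow> ('e \<Rightarrow> 'a set) set \<Rightarrow> ('e \<Rightarrow> 'a set) set \<Rightarrow> 'e set \<Rightarrow> bool" where
  "pairwise_soft_Hausdorff X \<T>1 \<T>2 E \<longleftrightarrow>
     (\<forall>x\<in>X. \<forall>y\<in>X. x \<noteq> y \<longrightarrow>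
       (\<exists>F\<in>\<T>1. \<exists>G\<in>\<T>2. soft_mem E x F \<and> soft_mem E y G \<and> soft_inter E F G = soft_empty E))"

end

theory Submission
  imports Defs
begin

text \<open>
  Both conditions say that \<open>x\<close> has a \<open>\<T>1\<close>-open neighbourhood \<open>F\<close> that is disjoint from some
  \<open>\<T>2\<close>-open neighbourhood of \<open>y\<close>. The link is that \<open>F\<close> is disjoint from a \<open>\<T>2\<close>-open soft set
  \<open>G\<close> exactly when \<open>G\<close> lies in the exterior of \<open>F\<close>, the complement of its \<open>\<T>2\<close>-closure. For one
  direction, the complement of \<open>G\<close> is closed and contains \<open>F\<close>, hence contains the closure of \<open>F\<close>
  (\<open>soft_open_disjoint_soft_closure\<close>). For the other, the exterior of \<open>F\<close> is itself
  \<open>\<T>2\<close>-open (\<open>soft_open_compl_soft_closure\<close>), so it can serve as \<open>G\<close>.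

  The soft membership \<open>y \<in> (G, E)\<close> asks for \<open>y \<in> G e\<close> at every parameter \<open>e\<close>. It is therefore not
  enough that \<open>y\<close> fails to be a soft member of the closure of \<open>F\<close>, since that can happen at a
  single parameter; membership in the complement excludes \<open>y\<close> from the closure at all of them.
\<close>

lemma soft_diff_soft_univ: "soft_diff E (soft_univ X E) F = soft_compl X E F"
  by (simp add: soft_diff_def soft_univ_def soft_compl_def fun_eq_iff)

lemma soft_compl_soft_compl:
  assumes "F \<in> soft_sets X E"
  shows "soft_compl X E (soft_compl X E F) = F"
proof
  fix e
  show "soft_compl X E (soft_compl X E F) e = F e"
    using assms by (cases "e \<in> E") (auto simp: soft_sets_def soft_compl_def PiE_iff extensional_def)
qed

lemma soft_compl_soft_Inter:
  "soft_compl X E (soft_Inter E \<F>) = soft_Union E (soft_compl X E ` \<F>)"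
  by (auto simp: soft_compl_def soft_Inter_def soft_Union_def fun_eq_iff)

lemma soft_inter_eq_soft_empty_iff:
  "soft_inter E F G = soft_empty E \<longleftrightarrow> (\<forall>e\<in>E. F e \<inter> G e = {})"
  by (auto simp: soft_inter_def soft_empty_def fun_eq_iff)

lemma soft_closed_soft_compl:
  assumes "soft_topology X E \<T>" and "G \<in> \<T>"
  shows "soft_closed X E \<T> (soft_compl X E G)"
proof -
  have "G \<in> soft_sets X E"
    using assms by (auto simp: soft_topology_def)
  moreover have "soft_compl X E G \<in> soft_sets X E"
    by (auto simp: soft_sets_def soft_compl_def)
  ultimately show ?thesis
    using assms(2) by (simp add: soft_closed_def soft_compl_soft_compl)
qed

lemma soft_subset_soft_closure: "soft_subset E F (soft_closure X E \<T> F)"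
  by (auto simp: soft_subset_def soft_closure_def soft_Inter_def)

lemma soft_closure_minimal:
  assumes "soft_closed X E \<T> H" and "soft_subset E F H"
  shows "soft_subset E (soft_closure X E \<T> F) H"
  using assms by (auto simp: soft_subset_def soft_closure_def soft_Inter_def)

text \<open>
  By De Morgan, the complement of an intersection of closed soft sets is a union of open ones.
\<close>

lemma soft_open_compl_soft_closure:
  assumes "soft_topology X E \<T>"
  shows "soft_compl X E (soft_closure X E \<T> F) \<in> \<T>"
proof -
  have "soft_compl X E ` {H. soft_closed X E \<T> H \<and> soft_subset E F H} \<subseteq> \<T>"
    by (auto simp: soft_closed_def)
  then show ?thesis
    using assms by (simp add: soft_closure_def soft_compl_soft_Inter soft_topology_def)
qed

text \<open>
  Disjointness from an open soft set passes to the closure, because the complement of the open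
  soft set takes part in the intersection that defines the closure.
\<close>

lemma soft_open_disjoint_soft_closure:
  assumes top: "soft_topology X E \<T>" and "G \<in> \<T>" and F: "F \<in> soft_sets X E"
    and disj: "soft_inter E F G = soft_empty E"
  shows "soft_inter E (soft_closure X E \<T> F) G = soft_empty E"
proof -
  have "soft_subset E F (soft_compl X E G)"
    using F disj
    by (fastforce simp: soft_subset_def soft_compl_def soft_sets_def soft_inter_eq_soft_empty_iff)
  then have "soft_subset E (soft_closure X E \<T> F) (soft_compl X E G)"
    by (rule soft_closure_minimal[OF soft_closed_soft_compl[OF top \<open>G \<in> \<T>\<close>]])
  then show ?thesis
    by (auto simp: soft_inter_eq_soft_empty_iff soft_subset_def soft_compl_def)
qed

theorem theorem1:
  fixes X :: "'a set" and E :: "'e set"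
    and \<T>1 \<T>2 :: "('e \<Rightarrow> 'a set) set"
  assumes "bi_soft_topological_space X \<T>1 \<T>2 E"
  shows "pairwise_soft_Hausdorff X \<T>1 \<T>2 E \<longleftrightarrow>
    (\<forall>x\<in>X. \<forall>y\<in>X. y \<noteq> x \<longrightarrow>
      (\<exists>F\<in>\<T>1. soft_mem E x F \<and>
        soft_mem E y (soft_diff E (soft_univ X E) (soft_closure X E \<T>2 F))))"
proof -
  have top1: "\<T>1 \<subseteq> soft_sets X E" and top2: "soft_topology X E \<T>2"
    using assms by (auto simp: bi_soft_topological_space_def soft_topology_def)
  have separation:
    "(\<exists>G\<in>\<T>2. soft_mem E y G \<and> soft_inter E F G = soft_empty E) \<longleftrightarrow>
      soft_mem E y (soft_compl X E (soft_closure X E \<T>2 F))"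
    if "F \<in> \<T>1" and "y \<in> X" for F y
  proof
    assume "\<exists>G\<in>\<T>2. soft_mem E y G \<and> soft_inter E F G = soft_empty E"
    then obtain G where "G \<in> \<T>2" and y: "soft_mem E y G"
      and "soft_inter E F G = soft_empty E"
      by blast
    then have "soft_inter E (soft_closure X E \<T>2 F) G = soft_empty E"
      using soft_open_disjoint_soft_closure[OF top2] top1 \<open>F \<in> \<T>1\<close> by blast
    then show "soft_mem E y (soft_compl X E (soft_closure X E \<T>2 F))"
      using y \<open>y \<in> X\<close> by (auto simp: soft_mem_def soft_compl_def soft_inter_eq_soft_empty_iff)
  next
    assume y: "soft_mem E y (soft_compl X E (soft_closure X E \<T>2 F))"
    have "soft_inter E F (soft_compl X E (soft_closure X E \<T>2 F)) = soft_empty E"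
      using soft_subset_soft_closure[of E F X \<T>2]
      by (auto simp: soft_inter_eq_soft_empty_iff soft_subset_def soft_compl_def)
    with y show "\<exists>G\<in>\<T>2. soft_mem E y G \<and> soft_inter E F G = soft_empty E"
      using soft_open_compl_soft_closure[OF top2] by blast
  qed
  have Hausdorff_at:
    "(\<exists>F\<in>\<T>1. \<exists>G\<in>\<T>2. soft_mem E x F \<and> soft_mem E y G \<and> soft_inter E F G = soft_empty E) \<longleftrightarrow>
      (\<exists>F\<in>\<T>1. soft_mem E x F \<and> soft_mem E y (soft_compl X E (soft_closure X E \<T>2 F)))"
    if "y \<in> X" for x y
    using separation[OF _ that] by blast
  show ?thesis
    unfolding pairwise_soft_Hausdorff_def soft_diff_soft_univ
  proof (intro ball_cong refl)
    fix x y
    assume "y \<in> X"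
    show "(x \<noteq> y \<longrightarrow> (\<exists>F\<in>\<T>1. \<exists>G\<in>\<T>2. soft_mem E x F \<and> soft_mem E y G \<and>
            soft_inter E F G = soft_empty E)) \<longleftrightarrow>
        (y \<noteq> x \<longrightarrow> (\<exists>F\<in>\<T>1. soft_mem E x F \<and>
            soft_mem E y (soft_compl X E (soft_closure X E \<T>2 F))))"
      unfolding Hausdorff_at[OF \<open>y \<in> X\<close>] eq_commute[of x y] by (rule refl)
  qed
qed

end
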